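(* Fix $n\ge1$. Let $H=(h_{a,b})_{0\le a\le b\le n}$ be an $h$-array with derived $t$-arrays $T_1(H)$ and $T_2(H)$. Then $H$ is a hive for $GL_n$ if and only if both $T_1(H)$ and $T_2(H)$ are GT patterns for $GL_n$.
   Context: A $t$-array is an array of integers $T=(t^{(i)}_j)_{1\le j\le i\le n}$. It is a GT pattern for $GL_n$ if it satisfies IC(1): $t^{(i+1)}_j\ge t^{(i)}_j$ and IC(2): $t^{(i)}_j\ge t^{(i+1)}_{j+1}$ for all $1\le j\le i\le n-1$. An $h$-array is an array of nonnegative integers $H=(h_{a,b})_{0\le a\le b\le n}$ with $h_{0,0}=0$. It is a hive for $GL_n$ if it satisfies the rhombus conditions RC(1): $h_{a,b}+h_{a-1,b-1}\ge h_{a-1,b}+h_{a,b-1}$ for $1\le a<b\le n$; RC(2): $h_{a-1,b}+h_{a,b}\ge h_{a,b+1}+h_{a-1,b-1}$ for $1\le a\le b<n$; RC(3): $h_{a,b}+h_{a,b+1}\ge h_{a+1,b+1}+h_{a-1,b}$ for $1\le a\le b<n$. The derived $t$-arrays $T_1(H)=(x^{(i)}_j)$ and $T_2(H)=(y^{(i)}_j)$ are defined, for $0\le a\le b\le n-1$, by $x^{(n-a)}_{b+1-a}=h_{a,b+1}-h_{a,b}$ and $y^{(b+1)}_{a+1}=h_{a+1,b+1}-h_{a,b+1}$. *)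

theory Defs
  imports Main
begin

text \<open>Arrays are functions of two natural-number indices, the row index \<open>i\<close> first in \<open>t i j\<close>.
  Only the entries \<open>t i j\<close> with \<open>1 \<le> j \<le> i \<le> n\<close> and \<open>h a b\<close> with \<open>0 \<le> a \<le> b \<le> n\<close>
  are meaningful, and the predicates below inspect no others.\<close>

type_synonym t_array = "nat \<Rightarrow> nat \<Rightarrow> int"

definition IC1 :: "nat \<Rightarrow> t_array \<Rightarrow> bool" where
  "IC1 n t \<longleftrightarrow> (\<forall>i j. 1 \<le> j \<and> j \<le> i \<and> i \<le> n - 1 \<longrightarrow> t (i + 1) j \<ge> t i j)"

definition IC2 :: "nat \<Rightarrow> t_array \<Rightarrow> bool" where
  "IC2 n t \<longleftrightarrow> (\<forall>i j. 1 \<le> j \<and> j \<le> i \<and> i \<le> n - 1 \<longrightarrow> t i j \<ge> t (i + 1) (j + 1))"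

definition GT_pattern :: "nat \<Rightarrow> t_array \<Rightarrow> bool" where
  "GT_pattern n t \<longleftrightarrow> IC1 n t \<and> IC2 n t"

text \<open>The entries of an \<open>h\<close>-array are typed as integers so that differences are not truncated;
  nonnegativity is part of the predicate.\<close>

definition h_array :: "nat \<Rightarrow> (nat \<Rightarrow> nat \<Rightarrow> int) \<Rightarrow> bool" where
  "h_array n h \<longleftrightarrow> (\<forall>a b. a \<le> b \<and> b \<le> n \<longrightarrow> 0 \<le> h a b) \<and> h 0 0 = 0"

definition RC1 :: "nat \<Rightarrow> (nat \<Rightarrow> nat \<Rightarrow> int) \<Rightarrow> bool" where
  "RC1 n h \<longleftrightarrow> (\<forall>a b. 1 \<le> a \<and> a < b \<and> b \<le> n \<longrightarrow>
     h a b + h (a - 1) (b - 1) \<ge> h (a - 1) b + h a (b - 1))"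

definition RC2 :: "nat \<Rightarrow> (nat \<Rightarrow> nat \<Rightarrow> int) \<Rightarrow> bool" where
  "RC2 n h \<longleftrightarrow> (\<forall>a b. 1 \<le> a \<and> a \<le> b \<and> b < n \<longrightarrow>
     h (a - 1) b + h a b \<ge> h a (b + 1) + h (a - 1) (b - 1))"

definition RC3 :: "nat \<Rightarrow> (nat \<Rightarrow> nat \<Rightarrow> int) \<Rightarrow> bool" where
  "RC3 n h \<longleftrightarrow> (\<forall>a b. 1 \<le> a \<and> a \<le> b \<and> b < n \<longrightarrow>
     h a b + h a (b + 1) \<ge> h (a + 1) (b + 1) + h (a - 1) b)"

definition hive :: "nat \<Rightarrow> (nat \<Rightarrow> nat \<Rightarrow> int) \<Rightarrow> bool" where
  "hive n h \<longleftrightarrow> h_array n h \<and> RC1 n h \<and> RC2 n h \<and> RC3 n h"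

text \<open>For \<open>0 \<le> a \<le> b \<le> n - 1\<close> the derived arrays \<open>x\<close> and \<open>y\<close> are usually given by
  \<open>x (n - a) (b + 1 - a) = h a (b + 1) - h a b\<close> and
  \<open>y (b + 1) (a + 1) = h (a + 1) (b + 1) - h a (b + 1)\<close>.
  Here the index substitutions, which are bijections onto \<open>1 \<le> j \<le> i \<le> n\<close>, are inverted:
  \<open>a = n - i\<close>, \<open>b = n - i + j - 1\<close> for the first and \<open>a = j - 1\<close>, \<open>b = i - 1\<close> for the second.
  The two \<open>entry\<close> lemmas recover the usual form, and the two \<open>index\<close> lemmas show that
  it determines every meaningful entry.\<close>

definition T1 :: "nat \<Rightarrow> (nat \<Rightarrow> nat \<Rightarrow> int) \<Rightarrow> t_array" where
  "T1 n h i j = h (n - i) (n - i + j) - h (n - i) (n - i + j - 1)"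

definition T2 :: "(nat \<Rightarrow> nat \<Rightarrow> int) \<Rightarrow> t_array" where
  "T2 h i j = h j i - h (j - 1) i"

lemma T1_entry:
  assumes "a \<le> b" "b \<le> n - 1" "1 \<le> n"
  shows "T1 n h (n - a) (b + 1 - a) = h a (b + 1) - h a b"
proof -
  have "n - (n - a) = a" "a + (b + 1 - a) = b + 1"
    using assms by auto
  then show ?thesis by (simp add: T1_def)
qed

lemma T1_index:
  fixes i j n :: nat
  assumes "1 \<le> j" "j \<le> i" "i \<le> n"
  shows "\<exists>a b. a \<le> b \<and> b \<le> n - 1 \<and> i = n - a \<and> j = b + 1 - a"
proof (intro exI conjI)
  let ?a = "n - i" and ?b = "n - i + j - 1"
  show "?a \<le> ?b" "?b \<le> n - 1" "i = n - ?a" "j = ?b + 1 - ?a" using assms by auto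
qed

lemma T2_entry: "T2 h (b + 1) (a + 1) = h (a + 1) (b + 1) - h a (b + 1)"
  by (simp add: T2_def)

lemma T2_index:
  fixes i j n :: nat
  assumes "1 \<le> j" "j \<le> i" "i \<le> n"
  shows "\<exists>a b. a \<le> b \<and> b \<le> n - 1 \<and> i = b + 1 \<and> j = a + 1"
proof (intro exI conjI)
  let ?a = "j - 1" and ?b = "i - 1"
  show "?a \<le> ?b" "?b \<le> n - 1" "i = ?b + 1" "j = ?a + 1" using assms by auto
qed

end

theory Submission
  imports Defs
begin

text \<open>The interlacing inequalities of the derived arrays are the rhombus inequalities after
  reindexing: \<open>IC1\<close> and \<open>IC2\<close> of the first array are \<open>RC2\<close> and \<open>RC1\<close>, those of the second
  are \<open>RC1\<close> and \<open>RC3\<close>.\<close>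

lemma IC1_T1_iff_RC2: "IC1 n (T1 n h) \<longleftrightarrow> RC2 n h"
proof
  assume IC: "IC1 n (T1 n h)"
  show "RC2 n h"
    unfolding RC2_def
  proof (intro allI impI)
    fix a b assume ab: "1 \<le> a \<and> a \<le> b \<and> b < n"
    \<comment> \<open>The entry with indices \<open>n - a\<close> and \<open>b + 1 - a\<close> is
      \<open>h a (b + 1) - h a b\<close>. Raising only its row index lowers both indices of
      \<open>h\<close> by one.\<close>
    then have "1 \<le> b + 1 - a \<and> b + 1 - a \<le> n - a \<and> n - a \<le> n - 1"
      by auto
    then have "T1 n h (n - a) (b + 1 - a) \<le> T1 n h (n - a + 1) (b + 1 - a)"
      using IC unfolding IC1_def by blast
    \<comment> \<open>The bounds on \<open>a\<close> and \<open>b\<close> keep these natural-number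
      subtractions from truncating.\<close>
    moreover have "n - (n - a) = a" "n - (n - a + 1) = a - 1" "a + (b + 1 - a) = b + 1"
      "a - 1 + (b + 1 - a) = b"
      using ab by auto
    ultimately show "h a (b + 1) + h (a - 1) (b - 1) \<le> h (a - 1) b + h a b"
      by (simp add: T1_def)
  qed
next
  assume RC: "RC2 n h"
  show "IC1 n (T1 n h)"
    unfolding IC1_def
  proof (intro allI impI)
    fix i j assume ij: "1 \<le> j \<and> j \<le> i \<and> i \<le> n - 1"
    define a b where "a = n - i" and "b = n - i + j - 1"
    have "1 \<le> a \<and> a \<le> b \<and> b < n"
      using ij by (auto simp: a_def b_def)
    then have "h a (b + 1) + h (a - 1) (b - 1) \<le> h (a - 1) b + h a b"
      using RC unfolding RC2_def by blast
    moreover have "n - i = a" "n - (i + 1) = a - 1" "a + j = b + 1" "a - 1 + j = b"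
      using ij by (auto simp: a_def b_def)
    ultimately show "T1 n h i j \<le> T1 n h (i + 1) j"
      by (simp add: T1_def)
  qed
qed

text \<open>Raising both indices of an entry of \<open>T1\<close> lowers the first index of
  \<open>h\<close> and fixes the second, so two differences over the same \<open>b - 1\<close>,
  \<open>b\<close> are compared.\<close>

lemma IC2_T1_iff_RC1: "IC2 n (T1 n h) \<longleftrightarrow> RC1 n h"
proof
  assume IC: "IC2 n (T1 n h)"
  show "RC1 n h"
    unfolding RC1_def
  proof (intro allI impI)
    fix a b assume ab: "1 \<le> a \<and> a < b \<and> b \<le> n"
    then have "1 \<le> b - a \<and> b - a \<le> n - a \<and> n - a \<le> n - 1"
      by auto
    then have "T1 n h (n - a + 1) (b - a + 1) \<le> T1 n h (n - a) (b - a)"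
      using IC unfolding IC2_def by blast
    moreover have "n - (n - a) = a" "n - (n - a + 1) = a - 1" "a + (b - a) = b"
      "a - 1 + (b - a + 1) = b"
      using ab by auto
    ultimately show "h (a - 1) b + h a (b - 1) \<le> h a b + h (a - 1) (b - 1)"
      by (simp add: T1_def)
  qed
next
  assume RC: "RC1 n h"
  show "IC2 n (T1 n h)"
    unfolding IC2_def
  proof (intro allI impI)
    fix i j assume ij: "1 \<le> j \<and> j \<le> i \<and> i \<le> n - 1"
    \<comment> \<open>Here \<open>b\<close> is the upper end of the difference
      \<open>T1 n h i j\<close>, not the lower one, which matches the range
      \<open>a < b \<le> n\<close> of \<open>RC1\<close>.\<close>
    define a b where "a = n - i" and "b = n - i + j"
    have "1 \<le> a \<and> a < b \<and> b \<le> n"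
      using ij by (auto simp: a_def b_def)
    then have "h (a - 1) b + h a (b - 1) \<le> h a b + h (a - 1) (b - 1)"
      using RC unfolding RC1_def by blast
    moreover have "n - i = a" "n - (i + 1) = a - 1" "a + j = b" "a - 1 + (j + 1) = b"
      using ij by (auto simp: a_def b_def)
    ultimately show "T1 n h (i + 1) (j + 1) \<le> T1 n h i j"
      by (simp add: T1_def)
  qed
qed

text \<open>The rhombus is that of \<open>IC2_T1_iff_RC1\<close>, with its four values grouped into
  differences in the first index instead of the second.\<close>

lemma IC1_T2_iff_RC1: "IC1 n (T2 h) \<longleftrightarrow> RC1 n h"
proof
  assume IC: "IC1 n (T2 h)"
  show "RC1 n h"
    unfolding RC1_def
  proof (intro allI impI)
    fix a b assume ab: "1 \<le> a \<and> a < b \<and> b \<le> n"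
    \<comment> \<open>Strictness of \<open>a < b\<close> is what gives row \<open>b - 1\<close> an
      entry in position \<open>a\<close>.\<close>
    then have "1 \<le> a \<and> a \<le> b - 1 \<and> b - 1 \<le> n - 1"
      by auto
    then have "T2 h (b - 1) a \<le> T2 h (b - 1 + 1) a"
      using IC unfolding IC1_def by blast
    moreover have "b - 1 + 1 = b"
      using ab by auto
    ultimately show "h (a - 1) b + h a (b - 1) \<le> h a b + h (a - 1) (b - 1)"
      by (simp add: T2_def)
  qed
next
  assume RC: "RC1 n h"
  show "IC1 n (T2 h)"
    unfolding IC1_def
  proof (intro allI impI)
    fix i j assume "1 \<le> j \<and> j \<le> i \<and> i \<le> n - 1"
    then have "1 \<le> j \<and> j < i + 1 \<and> i + 1 \<le> n"
      by auto
    then have "h (j - 1) (i + 1) + h j (i + 1 - 1) \<le> h j (i + 1) + h (j - 1) (i + 1 - 1)"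
      using RC unfolding RC1_def by blast
    then show "T2 h i j \<le> T2 h (i + 1) j"
      by (simp add: T2_def)
  qed
qed

lemma IC2_T2_iff_RC3: "IC2 n (T2 h) \<longleftrightarrow> RC3 n h"
proof -
  \<comment> \<open>With \<open>a = j\<close> and \<open>b = i\<close> the ranges already agree; for
    \<open>n = 0\<close> both sides are false, since they force \<open>1 \<le> i\<close>.\<close>
  have "1 \<le> j \<and> j \<le> i \<and> i \<le> n - 1 \<longleftrightarrow> 1 \<le> j \<and> j \<le> i \<and> i < n" for i j
    by auto
  moreover have "T2 h (i + 1) (j + 1) \<le> T2 h i j \<longleftrightarrow>
      h (j + 1) (i + 1) + h (j - 1) i \<le> h j i + h j (i + 1)" for i j
    by (auto simp: T2_def)
  ultimately show ?thesis
    unfolding IC2_def RC3_def by blast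
qed

theorem theorem2p5:
  fixes n :: nat and h :: "nat \<Rightarrow> nat \<Rightarrow> int"
  assumes "n \<ge> 1"
    and "h_array n h"
  shows "hive n h \<longleftrightarrow> GT_pattern n (T1 n h) \<and> GT_pattern n (T2 h)"
  \<comment> \<open>This supplies the \<open>h_array\<close> part of \<open>hive\<close>;
    \<open>RC1\<close> arises from both derived arrays, so four interlacing conditions yield three
    rhombus conditions.\<close>
  using assms(2)
  by (auto simp: hive_def GT_pattern_def IC1_T1_iff_RC2 IC2_T1_iff_RC1 IC1_T2_iff_RC1 IC2_T2_iff_RC3)

end
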